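(* Let $x_0$ be a primitive word over a finite alphabet $A$, and let $x_1$ be a proper prefix of $x_0$, i.e. $x_0 = x_1x_2$ with $x_1$ and $x_2$ non-empty words. Let $e_1 \geq 1$ and $e_2 \geq 1$ be integers with $e_1+e_2 \geq 3$, and let $W = x_0^{e_1}x_1x_0^{e_2}$. Let $w_1$ be the factor of $W$ of length $|x_0|$ that ends with the core of the interrupt of $W$ (its last letter is at the same position of $W$ as the last letter of the core), and let $w_2$ be the factor of $W$ of length $|x_0|$ that starts with the core of the interrupt of $W$ (its first letter is at the same position of $W$ as the first letter of the core). Then neither $w_1$ nor $w_2$ belongs to the conjugacy class $Cl(x_0)$ of $x_0$.
   Context: Words are finite sequences of letters of a finite alphabet $A$; $|w|$ is the length of $w$; multiplication of words is concatenation, and $w^n$ is the concatenation of $n$ copies of $w$. A factor of a word is a contiguous block of it. A word is primitive if it cannot be written as $y^k$ for a word $y$ and an integer $k \geq 2$. The conjugacy class is $Cl(x) = \{x\} \cup \{vu : x = uv,\ u,v \text{ non-empty}\}$. For words $x,y$, $\operatorname{lcp}(x,y)$ is their longest common prefix and $\operatorname{lcs}(x,y)$ their longest common suffix (both are words, possibly empty). Core of the interrupt: let $W = x_0^{e_1}x_1x_0^{e_2}$ with $x_0 = x_1x_2$ primitive, $x_1,x_2$ non-empty, $e_1,e_2\ge 1$, $e_1+e_2\ge 3$. Let $\tilde p$ be the prefix of $x_1x_2$ of length $|\operatorname{lcp}(x_1x_2, x_2x_1)|+1$, and let $\tilde s$ be the suffix of $x_2x_1$ of length $|\operatorname{lcs}(x_1x_2,x_2x_1)|+1$.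 The core of the interrupt of $W$ is the occurrence in $W$ of the factor $\tilde s\tilde p$ that is preceded by exactly $|x_0^{e_1}|+|x_1|-|\operatorname{lcs}(x_1x_2,x_2x_1)|-1$ letters of $W$; that is, the occurrence of $\tilde s$ is a suffix of the prefix $x_0^{e_1}x_1$ of $W$ and the occurrence of $\tilde p$ is a prefix of the remaining suffix $x_0^{e_2}$ of $W$. (It is known that, for $x_1x_2$ primitive, $|\operatorname{lcp}(x_1x_2,x_2x_1)|+|\operatorname{lcs}(x_1x_2,x_2x_1)| \leq |x_1x_2|-2$, so the core has length at most $|x_0|$.) *)

theory Defs
  imports "HOL-Library.Sublist"
begin

definition word_pow :: "'a list \<Rightarrow> nat \<Rightarrow> 'a list" where
  "word_pow w n = concat (replicate n w)"

text \<open>The empty word is its own square, hence not primitive.\<close>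

definition primitive_word :: "'a list \<Rightarrow> bool" where
  "primitive_word w \<longleftrightarrow> \<not> (\<exists>y k. k \<ge> 2 \<and> w = word_pow y k)"

definition Cl :: "'a list \<Rightarrow> 'a list set" where
  "Cl x = {x} \<union> {v @ u | u v. x = u @ v \<and> u \<noteq> [] \<and> v \<noteq> []}"

abbreviation lcp :: "'a list \<Rightarrow> 'a list \<Rightarrow> 'a list" where
  "lcp \<equiv> longest_common_prefix"

definition lcs :: "'a list \<Rightarrow> 'a list \<Rightarrow> 'a list" where
  "lcs x y = rev (lcp (rev x) (rev y))"

lemma lcs_suffix1: "suffix (lcs x y) x"
  and lcs_suffix2: "suffix (lcs x y) y"
  by (simp_all add: lcs_def suffix_to_prefix longest_common_prefix_prefix1
        longest_common_prefix_prefix2)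

lemma lcs_max_suffix: "suffix z x \<Longrightarrow> suffix z y \<Longrightarrow> suffix z (lcs x y)"
  by (simp add: lcs_def suffix_to_prefix longest_common_prefix_max_prefix)

definition occurs_at :: "'a list \<Rightarrow> nat \<Rightarrow> 'a list \<Rightarrow> bool" where
  "occurs_at u i W \<longleftrightarrow> (\<exists>p s. W = p @ u @ s \<and> length p = i)"

text \<open>The core of the interrupt is an occurrence, given by the word \<open>core_word\<close>
  and the number \<open>core_start\<close> of letters of \<open>word_pow (x1 @ x2) e1 @ x1 @ word_pow (x1 @ x2) e2\<close>
  that precede it.\<close>

definition core_p :: "'a list \<Rightarrow> 'a list \<Rightarrow> 'a list" where
  "core_p x1 x2 = take (length (lcp (x1 @ x2) (x2 @ x1)) + 1) (x1 @ x2)"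

definition core_s :: "'a list \<Rightarrow> 'a list \<Rightarrow> 'a list" where
  "core_s x1 x2 =
     drop (length (x2 @ x1) - (length (lcs (x1 @ x2) (x2 @ x1)) + 1)) (x2 @ x1)"

definition core_word :: "'a list \<Rightarrow> 'a list \<Rightarrow> 'a list" where
  "core_word x1 x2 = core_s x1 x2 @ core_p x1 x2"

definition core_start :: "'a list \<Rightarrow> 'a list \<Rightarrow> nat \<Rightarrow> nat" where
  "core_start x1 x2 e1 =
     length (word_pow (x1 @ x2) e1) + length x1 - length (lcs (x1 @ x2) (x2 @ x1)) - 1"

text \<open>The remaining facts show that, for \<open>x1 @ x2\<close> primitive, no truncation occurs in
  the definitions above, that the core does occur at \<open>core_start\<close>, and that the two
  factors of length \<open>|x1 @ x2|\<close> ending and starting with the core exist.\<close>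

lemma length_word_pow: "length (word_pow w n) = n * length w"
  by (induction n) (auto simp: word_pow_def)

lemma word_pow_Suc: "word_pow w (Suc n) = w @ word_pow w n"
  by (simp add: word_pow_def)

lemma word_pow_Suc': "word_pow w (Suc n) = word_pow w n @ w"
  by (simp add: word_pow_def replicate_append_same[symmetric])

lemma primitive_not_commute:
  assumes "primitive_word (x1 @ x2)" "x1 \<noteq> []" "x2 \<noteq> []"
  shows "x1 @ x2 \<noteq> x2 @ x1"
proof
  assume "x1 @ x2 = x2 @ x1"
  from comm_append_is_replicate[OF assms(2,3) this]
  obtain n zs where "n > 1" "concat (replicate n zs) = x1 @ x2" by blast
  then have "n \<ge> 2" "x1 @ x2 = word_pow zs n"
    by (simp_all add: word_pow_def)
  then show False
    using assms(1) unfolding primitive_word_def by blast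
qed

lemma length_lcp_less:
  assumes "primitive_word (x1 @ x2)" "x1 \<noteq> []" "x2 \<noteq> []"
  shows "length (lcp (x1 @ x2) (x2 @ x1)) < length (x1 @ x2)"
proof (rule ccontr)
  assume "\<not> ?thesis"
  moreover obtain a b where
    a: "x1 @ x2 = lcp (x1 @ x2) (x2 @ x1) @ a" and b: "x2 @ x1 = lcp (x1 @ x2) (x2 @ x1) @ b"
    using longest_common_prefix_prefix1 longest_common_prefix_prefix2 by (metis prefixE)
  moreover have "length (x1 @ x2) = length (lcp (x1 @ x2) (x2 @ x1)) + length a"
    "length (x1 @ x2) = length (lcp (x1 @ x2) (x2 @ x1)) + length b"
    using arg_cong[OF a, of length] arg_cong[OF b, of length] by simp_all
  ultimately have "a = []" "b = []" by auto
  with a b show False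
    using primitive_not_commute[OF assms] by simp
qed

lemma length_lcs_less:
  assumes "primitive_word (x1 @ x2)" "x1 \<noteq> []" "x2 \<noteq> []"
  shows "length (lcs (x1 @ x2) (x2 @ x1)) < length (x1 @ x2)"
proof (rule ccontr)
  assume "\<not> ?thesis"
  moreover obtain a b where
    a: "x1 @ x2 = a @ lcs (x1 @ x2) (x2 @ x1)" and b: "x2 @ x1 = b @ lcs (x1 @ x2) (x2 @ x1)"
    using lcs_suffix1 lcs_suffix2 by (metis suffixE)
  moreover have "length (x1 @ x2) = length (lcs (x1 @ x2) (x2 @ x1)) + length a"
    "length (x1 @ x2) = length (lcs (x1 @ x2) (x2 @ x1)) + length b"
    using arg_cong[OF a, of length] arg_cong[OF b, of length] by simp_all
  ultimately have "a = []" "b = []" by auto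
  with a b show False
    using primitive_not_commute[OF assms] by simp
qed

lemma length_core_p:
  assumes "primitive_word (x1 @ x2)" "x1 \<noteq> []" "x2 \<noteq> []"
  shows "length (core_p x1 x2) = length (lcp (x1 @ x2) (x2 @ x1)) + 1"
  using length_lcp_less[OF assms] by (simp add: core_p_def)

lemma length_core_s:
  assumes "primitive_word (x1 @ x2)" "x1 \<noteq> []" "x2 \<noteq> []"
  shows "length (core_s x1 x2) = length (lcs (x1 @ x2) (x2 @ x1)) + 1"
  using length_lcs_less[OF assms] by (simp add: core_s_def)

lemma core_start_add:
  assumes "primitive_word (x1 @ x2)" "x1 \<noteq> []" "x2 \<noteq> []" "e1 \<ge> 1"
  shows "core_start x1 x2 e1 + length (core_s x1 x2) = length (word_pow (x1 @ x2) e1 @ x1)"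
proof -
  have "length (x1 @ x2) \<le> length (word_pow (x1 @ x2) e1)"
    using assms(4) by (cases e1) (auto simp: word_pow_Suc)
  then show ?thesis
    using length_core_s[OF assms(1-3)] length_lcs_less[OF assms(1-3)]
    by (simp add: core_start_def)
qed

lemma core_occurs:
  assumes "primitive_word (x1 @ x2)" "x1 \<noteq> []" "x2 \<noteq> []" "e1 \<ge> 1" "e2 \<ge> 1"
  shows "occurs_at (core_word x1 x2) (core_start x1 x2 e1)
           (word_pow (x1 @ x2) e1 @ x1 @ word_pow (x1 @ x2) e2)" (is "occurs_at _ _ ?W")
proof -
  obtain n m where e: "e1 = Suc n" "e2 = Suc m"
    using assms(4,5) by (metis Suc_le_D One_nat_def)
  obtain a where a: "x2 @ x1 = a @ core_s x1 x2"
    unfolding core_s_def by (metis append_take_drop_id)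
  obtain b where b: "x1 @ x2 = core_p x1 x2 @ b"
    unfolding core_p_def by (metis append_take_drop_id)
  have l: "word_pow (x1 @ x2) e1 @ x1 = word_pow (x1 @ x2) n @ x1 @ a @ core_s x1 x2"
    using a by (simp add: e word_pow_Suc')
  have r: "word_pow (x1 @ x2) e2 = core_p x1 x2 @ b @ word_pow (x1 @ x2) m"
    by (simp only: e word_pow_Suc) (metis b append.assoc)
  have "?W = (word_pow (x1 @ x2) e1 @ x1) @ word_pow (x1 @ x2) e2"
    by simp
  also have "\<dots> = (word_pow (x1 @ x2) n @ x1 @ a) @ core_word x1 x2
      @ b @ word_pow (x1 @ x2) m"
    by (simp only: l r core_word_def append.assoc)
  finally have "?W = \<dots>" .
  moreover have "length (word_pow (x1 @ x2) n @ x1 @ a) = core_start x1 x2 e1"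
    using core_start_add[OF assms(1-4)] arg_cong[OF l, of length] by simp
  ultimately show ?thesis
    unfolding occurs_at_def by blast
qed

lemma occurs_at_exists:
  assumes "i + n \<le> length W"
  shows "\<exists>u. length u = n \<and> occurs_at u i W"
proof (intro exI conjI)
  show "length (take n (drop i W)) = n" using assms by simp
  have "W = take i W @ take n (drop i W) @ drop n (drop i W)"
    by (simp only: append_take_drop_id)
  then show "occurs_at (take n (drop i W)) i W"
    unfolding occurs_at_def using assms by (metis add_leD1 length_take min.absorb2)
qed

lemma core_factors_exist:
  fixes x1 x2 :: "'a list" and e1 e2 :: nat
  defines "W \<equiv> word_pow (x1 @ x2) e1 @ x1 @ word_pow (x1 @ x2) e2"
  assumes "primitive_word (x1 @ x2)" "x1 \<noteq> []" "x2 \<noteq> []" "e1 \<ge> 1" "e2 \<ge> 1"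
  shows "\<exists>w i. length w = length (x1 @ x2) \<and> occurs_at w i W
           \<and> i + length w = core_start x1 x2 e1 + length (core_word x1 x2)"
    and "\<exists>w. length w = length (x1 @ x2)
           \<and> occurs_at w (core_start x1 x2 e1) W"
proof -
  have l: "length (x1 @ x2) \<le> length (word_pow (x1 @ x2) e)" if "e \<ge> 1" for e
    using that by (cases e) (auto simp: word_pow_Suc)
  have W: "length W =
      length (word_pow (x1 @ x2) e1 @ x1) + length (word_pow (x1 @ x2) e2)"
    by (simp add: W_def)
  note s = core_start_add[OF assms(2-5)]
  have c: "core_start x1 x2 e1 + length (core_word x1 x2) =
      length (word_pow (x1 @ x2) e1 @ x1) + length (core_p x1 x2)"
    using s by (simp add: core_word_def)
  have p: "length (core_p x1 x2) \<le> length (x1 @ x2)"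
    by (simp add: core_p_def)
  let ?i = "core_start x1 x2 e1 + length (core_word x1 x2) - length (x1 @ x2)"
  have i: "?i + length (x1 @ x2) = core_start x1 x2 e1 + length (core_word x1 x2)"
    using c l[OF assms(5)] by simp
  have "?i + length (x1 @ x2) \<le> length W"
    using i c p W l[OF assms(6)] by linarith
  from occurs_at_exists[OF this] i
  show "\<exists>w i. length w = length (x1 @ x2) \<and> occurs_at w i W
           \<and> i + length w = core_start x1 x2 e1 + length (core_word x1 x2)"
    by metis
  have "core_start x1 x2 e1 + length (x1 @ x2) \<le> length W"
    using s W l[OF assms(6)] by linarith
  from occurs_at_exists[OF this]
  show "\<exists>w. length w = length (x1 @ x2)
           \<and> occurs_at w (core_start x1 x2 e1) W" .
qed

end

theory Submission
  imports Defs "HOL-Library.Multiset"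
begin

text \<open>Around the interrupt, \<open>W\<close> reads \<open>(x2 @ x1) @ (x1 @ x2)\<close>. If \<open>q\<close> is the longest common
  prefix of these two conjugates of \<open>x0\<close>, with \<open>x1 @ x2 = q @ c # r\<close>, \<open>x2 @ x1 = q @ d # t\<close> and
  \<open>c \<noteq> d\<close>, then \<open>w1 = t @ q @ [c]\<close>. As a multiset of letters, this is \<open>x0\<close> with one \<open>d\<close>
  replaced by \<open>c\<close>, so it is not conjugate to \<open>x0\<close>. The case of \<open>w2\<close> is symmetric, with longest
  common suffixes.\<close>

lemma mset_eq_if_in_Cl: "w \<in> Cl x \<Longrightarrow> mset w = mset x"
  by (auto simp: Cl_def)

text \<open>With equal lengths neither of two distinct words is a prefix of the other, so a letter
  follows the common prefix in both; by maximality these letters differ.\<close>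

lemma lcp_mismatch:
  assumes "length x = length y" "x \<noteq> y"
  shows "\<exists>c d r t. x = lcp x y @ c # r \<and> y = lcp x y @ d # t \<and> c \<noteq> d"
  using assms
proof (induction x y rule: list_induct2)
  case (Cons a x b y)
  show ?case
  proof (cases "a = b")
    case True
    with Cons obtain c d r t where "x = lcp x y @ c # r" "y = lcp x y @ d # t" "c \<noteq> d"
      by blast
    then have "a # x = (a # lcp x y) @ c # r" "b # y = (a # lcp x y) @ d # t"
      using True by (metis append_Cons)+
    moreover have "lcp (a # x) (b # y) = a # lcp x y"
      using True by simp
    ultimately show ?thesis using \<open>c \<noteq> d\<close> by metis
  qed simp
qed simp

lemma lcs_mismatch:
  assumes "length x = length y" "x \<noteq> y"
  shows "\<exists>c d r t. x = r @ c # lcs x y \<and> y = t @ d # lcs x y \<and> c \<noteq> d"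
proof -
  have "length (rev x) = length (rev y)" "rev x \<noteq> rev y"
    using assms by simp_all
  then obtain c d r t where *: "rev x = rev (lcs x y) @ c # r" "rev y = rev (lcs x y) @ d # t" "c \<noteq> d"
    using lcp_mismatch unfolding lcs_def rev_rev_ident by blast
  have "x = rev r @ c # lcs x y" "y = rev t @ d # lcs x y"
    using *(1,2) by (simp_all only: rev_swap rev_append rev.simps rev_rev_ident append.assoc append.simps)
  with *(3) show ?thesis by blast
qed

text \<open>Lets an explicit factorisation of \<open>W\<close> determine \<open>w1\<close> and
  \<open>w2\<close>.\<close>

lemma occurs_at_unique:
  assumes "occurs_at u i W" "occurs_at v i W" "length u = length v"
  shows "u = v"
proof -
  have "take (length w) (drop i W) = w" if "occurs_at w i W" for w
    using that unfolding occurs_at_def by auto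
  with assms show ?thesis by metis
qed

text \<open>The last \<open>x2\<close> of the left power joins the middle \<open>x1\<close>, and the
  right power opens with a full \<open>x1 @ x2\<close>. The length equation places the boundary
  between the two conjugates where the core's two halves meet.\<close>

lemma interrupt_split:
  assumes "e1 \<ge> 1" "e2 \<ge> 1"
  obtains X Y where
    "word_pow (x1 @ x2) e1 @ x1 @ word_pow (x1 @ x2) e2 = X @ (x2 @ x1) @ (x1 @ x2) @ Y"
    "length (word_pow (x1 @ x2) e1 @ x1) = length X + length (x2 @ x1)"
proof -
  obtain m n where e: "e1 = Suc m" "e2 = Suc n"
    using assms by (metis Suc_le_D One_nat_def)
  have "word_pow (x1 @ x2) e1 = (word_pow (x1 @ x2) m @ x1) @ x2"
    by (simp add: e word_pow_Suc')
  moreover have "word_pow (x1 @ x2) e2 = (x1 @ x2) @ word_pow (x1 @ x2) n"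
    by (simp only: e word_pow_Suc)
  ultimately show thesis
    using that[of "word_pow (x1 @ x2) m @ x1" "word_pow (x1 @ x2) n"] by simp
qed

theorem theorem2p5:
  fixes A :: "'a set" and x0 x1 x2 W w1 w2 :: "'a list" and e1 e2 i1 i2 :: nat
  assumes "finite A" and "x0 \<in> lists A"
    and "primitive_word x0"
    and "x0 = x1 @ x2" and "x1 \<noteq> []" and "x2 \<noteq> []"
    and "e1 \<ge> 1" and "e2 \<ge> 1" and "e1 + e2 \<ge> 3"
    and "W = word_pow x0 e1 @ x1 @ word_pow x0 e2"
    and "occurs_at w1 i1 W" and "length w1 = length x0"
    and "i1 + length w1 = core_start x1 x2 e1 + length (core_word x1 x2)"
    and "occurs_at w2 i2 W" and "length w2 = length x0"
    and "i2 = core_start x1 x2 e1"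
  shows "w1 \<notin> Cl x0 \<and> w2 \<notin> Cl x0"
proof -
  let ?x = "x1 @ x2" and ?y = "x2 @ x1"
  have prim: "primitive_word ?x" using assms(3,4) by simp
  note ne = prim assms(5,6)
  have len: "length ?x = length ?y" by simp
  have neq: "?x \<noteq> ?y" by (rule primitive_not_commute[OF ne])
  have ms: "mset x0 = mset ?x" "mset x0 = mset ?y" by (simp_all add: assms(4))
  obtain X Y where W: "W = X @ ?y @ ?x @ Y"
    and X: "length (word_pow ?x e1 @ x1) = length X + length ?y"
    using interrupt_split[OF assms(7,8)] assms(4,10) by metis
  have start: "core_start x1 x2 e1 + length (lcs ?x ?y) + 1 = length X + length ?y"
    using core_start_add[OF ne assms(7)] length_core_s[OF ne] X by simp
  have core: "length (core_word x1 x2) = length (lcs ?x ?y) + 1 + (length (lcp ?x ?y) + 1)"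
    by (simp only: core_word_def length_append length_core_s[OF ne] length_core_p[OF ne])
  have "w1 \<notin> Cl x0"
  proof
    assume w1: "w1 \<in> Cl x0"
    define q where "q = lcp ?x ?y"
    obtain c d r t where x: "?x = q @ c # r" and y: "?y = q @ d # t" and "c \<noteq> d"
      using lcp_mismatch[OF len neq] unfolding q_def by metis
    have n: "length x0 = length q + Suc (length t)"
      using arg_cong[OF y, of length] assms(4) by simp
    \<comment> \<open>The core ends with this \<open>c\<close>, just after the second
      \<open>q\<close>. Going back \<open>length x0\<close> letters from there stops just after
      \<open>d\<close>.\<close>
    have "W = (X @ q @ [d]) @ (t @ q @ [c]) @ (r @ Y)"
      by (simp only: W x y) simp
    \<comment> \<open>The length of the common suffix cancels between \<open>start\<close> and
      \<open>core\<close>.\<close>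
    moreover have "i1 = length (X @ q @ [d])"
      using assms(12,13) start core n arg_cong[OF y, of length]
      unfolding q_def[symmetric] length_append list.size by linarith
    ultimately have "occurs_at (t @ q @ [c]) i1 W"
      unfolding occurs_at_def by blast
    then have "w1 = t @ q @ [c]"
      using occurs_at_unique[OF assms(11)] n assms(12) by simp
    then have "mset (t @ q @ [c]) = mset (q @ d # t)"
      using mset_eq_if_in_Cl[OF w1] ms(2) unfolding y by simp
    with \<open>c \<noteq> d\<close> show False by simp
  qed
  moreover have "w2 \<notin> Cl x0"
  proof
    assume w2: "w2 \<in> Cl x0"
    define q where "q = lcs ?x ?y"
    obtain c d r t where x: "?x = r @ c # q" and y: "?y = t @ d # q" and "c \<noteq> d"
      using lcs_mismatch[OF len neq] unfolding q_def by metis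
    have n: "length x0 = length r + Suc (length q)"
      using arg_cong[OF x, of length] assms(4) by simp
    \<comment> \<open>The core starts at this \<open>d\<close>. Reading \<open>length x0\<close>
      letters from there stops just before \<open>c\<close>, so \<open>d\<close> takes the place of
      \<open>c\<close>.\<close>
    have "W = (X @ t) @ (d # q @ r) @ (c # q @ Y)"
      by (simp only: W x y) simp
    moreover have "i2 = length (X @ t)"
      using assms(16) start arg_cong[OF y, of length]
      unfolding q_def[symmetric] length_append list.size by linarith
    ultimately have "occurs_at (d # q @ r) i2 W"
      unfolding occurs_at_def by blast
    then have "w2 = d # q @ r"
      using occurs_at_unique[OF assms(14)] n assms(15) by simp
    then have "mset (d # q @ r) = mset (r @ c # q)"
      using mset_eq_if_in_Cl[OF w2] ms(1) unfolding x by simp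
    with \<open>c \<noteq> d\<close> show False by simp
  qed
  ultimately show ?thesis by blast
qed

end
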